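(* Let $r\ge 8$ and $m\ge 2$ be integers, and put $$G_{m,r}=C_m^{\,r-5}\oplus C_{2m}^{\,4}\oplus C_{6m}.$$ Then $G_{m,r}$ has rank $r$, and there is a zero-sum-free sequence over $G_{m,r}$ of length $(r+10)m-r$ whose terms generate $G_{m,r}$. Moreover $\mathsf d^*(G_{m,r})=(r+9)m-r$, and hence $$\mathsf d(G_{m,r})-\mathsf d^*(G_{m,r})\ge m.$$
   Context: All groups are finite, abelian and written additively; $C_n$ denotes the cyclic group of order $n$. The rank of a group is its minimum number of generators. A sequence over a group $G$ is a finite unordered multiset of elements of $G$ (repetitions allowed); its length is the number of terms counted with multiplicity, and a subsequence is a sub-multiset. A sequence is zero-sum free if it has no nonempty subsequence whose terms sum to $0$. The small Davenport constant $\mathsf d(G)$ is the maximum length of a zero-sum-free sequence over $G$. If $G\cong C_{n_1}\oplus\cdots\oplus C_{n_s}$ with $1<n_1\mid\cdots\mid n_s$ (invariant-factor decomposition), then $\mathsf d^*(G)=\sum_{i=1}^s(n_i-1)$. *)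

theory Defs
  imports "HOL-Algebra.Product_Groups" "HOL-Algebra.FiniteProduct" "HOL-Library.Multiset"
begin

text \<open>Abelian groups are monoid records as in HOL-Algebra, so the additive notation of the
  mathematics becomes multiplicative: sums are products and \<open>0\<close> is \<open>\<one>\<^bsub>G\<^esub>\<close>.\<close>

definition cyclic_sum :: "nat list \<Rightarrow> (nat \<Rightarrow> int) monoid" where
  "cyclic_sum ns = product_group {..<length ns} (\<lambda>i. integer_mod_group (ns ! i))"

definition group_rank :: "('a, 'b) monoid_scheme \<Rightarrow> nat" where
  "group_rank G =
    (LEAST k. \<exists>A. A \<subseteq> carrier G \<and> finite A \<and> card A = k \<and> generate G A = carrier G)"

definition seq_sum :: "('a, 'b) monoid_scheme \<Rightarrow> 'a multiset \<Rightarrow> 'a" where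
  "seq_sum G S = finprod G (\<lambda>x. x [^]\<^bsub>G\<^esub> count S x) (set_mset S)"

definition zero_sum_free :: "('a, 'b) monoid_scheme \<Rightarrow> 'a multiset \<Rightarrow> bool" where
  "zero_sum_free G S \<longleftrightarrow>
    set_mset S \<subseteq> carrier G \<and> (\<forall>T. T \<subseteq># S \<and> T \<noteq> {#} \<longrightarrow> seq_sum G T \<noteq> \<one>\<^bsub>G\<^esub>)"

text \<open>For finite \<open>G\<close> the maximum is over a finite nonempty set: zero-sum free sequences have
  length less than the order of \<open>G\<close>.\<close>

definition small_davenport :: "('a, 'b) monoid_scheme \<Rightarrow> nat" where
  "small_davenport G = Max {size S | S. zero_sum_free G S}"

definition invariant_factors :: "('a, 'b) monoid_scheme \<Rightarrow> nat list \<Rightarrow> bool" where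
  "invariant_factors G ns \<longleftrightarrow>
    (\<forall>n \<in> set ns. 1 < n) \<and> sorted_wrt (dvd) ns \<and> G \<cong> cyclic_sum ns"

text \<open>A finite abelian group has exactly one list of invariant factors (the empty list for the
  trivial group).\<close>

definition d_star :: "('a, 'b) monoid_scheme \<Rightarrow> nat" where
  "d_star G = (\<Sum>n \<leftarrow> (THE ns. invariant_factors G ns). n - 1)"

definition G_mr :: "nat \<Rightarrow> nat \<Rightarrow> (nat \<Rightarrow> int) monoid" where
  "G_mr m r = cyclic_sum (replicate (r - 5) m @ replicate 4 (2 * m) @ [6 * m])"

end

theory Submission
  imports Defs "HOL-Algebra.Multiplicative_Group"
begin

text \<open>Suppose that \<open>g\<^sub>1, \<dots>, g\<^sub>r\<close> generate \<open>G\<close> and become independent modulo \<open>m G\<close>.  If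
  \<open>m g\<^sub>j\<close> taken \<open>v\<^sub>j\<close> times (\<open>j = 1, \<dots>, r\<close>) is a zero-sum free sequence over \<open>m G\<close>, then
  \<open>g\<^sub>j\<close> taken \<open>v\<^sub>j m + m - 1\<close> times is one over \<open>G\<close>: in a relation
  all exponents are divisible by \<open>m\<close>, and the quotients give a relation in \<open>m G\<close>.  Its length is
  \<open>r (m - 1) + m \<Sum> v\<^sub>j\<close>.  For \<open>G = C\<^sub>m\<^sup>r\<^sup>-\<^sup>5 \<oplus> C\<^sub>2\<^sub>m\<^sup>4 \<oplus> C\<^sub>6\<^sub>m\<close> we have
  \<open>m G = C\<^sub>2\<^sup>4 \<oplus> C\<^sub>6\<close>, which has a zero-sum free sequence of length
  ten (one more than \<open>d\<^sup>*\<close>) with only eight distinct terms; hence \<open>r \<ge> 8\<close> suffices.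

  The rank is bounded below by counting modulo \<open>m\<close>, and the invariant factors are recovered
  from the numbers of elements killed by each \<open>d\<close>.\<close>

section \<open>Sums of sequences and the finiteness behind the Davenport constant\<close>

lemma (in comm_group) seq_sum_add_mset:
  assumes "x \<in> carrier G" "set_mset M \<subseteq> carrier G"
  shows "seq_sum G (add_mset x M) = x \<otimes> seq_sum G M"
proof -
  let ?A = "insert x (set_mset M)"
  have sub: "?A \<subseteq> carrier G" using assms by simp
  have M: "seq_sum G M = finprod G (\<lambda>y. y [^] count M y) ?A"
    unfolding seq_sum_def
    by (rule finprod_mono_neutral_cong_left) (use sub in \<open>auto simp: not_in_iff\<close>)
  have x: "finprod G (\<lambda>y. if x = y then x else \<one>) ?A = x"
    using finprod_singleton[of x ?A "\<lambda>_. x"] assms by simp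
  have "seq_sum G (add_mset x M) = finprod G (\<lambda>y. (if x = y then x else \<one>) \<otimes> y [^] count M y) ?A"
    unfolding seq_sum_def
    by (rule finprod_cong') (use sub assms in \<open>auto simp: m_comm\<close>)
  also have "\<dots> = x \<otimes> seq_sum G M"
    unfolding M by (subst finprod_multf) (use sub assms x in auto)
  finally show ?thesis .
qed

lemma (in comm_group) seq_sum_replicate_mset:
  assumes "x \<in> carrier G"
  shows "seq_sum G (replicate_mset n x) = x [^] n"
proof (induction n)
  case 0
  then show ?case by (simp add: seq_sum_def)
next
  case (Suc n)
  then show ?case
    using assms by (simp add: seq_sum_add_mset m_comm)
qed

text \<open>By Lagrange, \<open>order G\<close> copies of one term already form a nonempty
  subsequence with trivial sum.\<close>

lemma (in comm_group) zero_sum_free_count_less_order: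
  assumes "finite (carrier G)" "zero_sum_free G S" "x \<in># S"
  shows "count S x < order G"
proof (rule ccontr)
  assume "\<not> count S x < order G"
  then have "replicate_mset (order G) x \<subseteq># S"
    using count_le_replicate_mset_subset_eq[of "order G" S x] by linarith
  moreover have "order G > 0"
    using assms(1) order_gt_0_iff_finite by blast
  moreover have "x \<in> carrier G"
    using assms unfolding zero_sum_free_def by auto
  moreover from this have "seq_sum G (replicate_mset (order G) x) = \<one>"
    by (simp add: seq_sum_replicate_mset pow_order_eq_1)
  ultimately show False
    using assms(2) unfolding zero_sum_free_def by auto
qed

text \<open>\<open>Max\<close> says something only about a finite set. The crude bound
  \<open>order G * order G\<close> supplies finiteness: at most \<open>order G\<close> distinct
  terms, each repeated fewer than \<open>order G\<close> times.\<close>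

lemma (in comm_group) size_le_small_davenport:
  assumes fin: "finite (carrier G)" and "zero_sum_free G S"
  shows "size S \<le> small_davenport G"
proof -
  have "size T \<le> order G * order G" if T: "zero_sum_free G T" for T
  proof -
    have "size T = (\<Sum>x\<in>set_mset T. count T x)"
      by (rule size_multiset_overloaded_eq)
    also have "\<dots> \<le> (\<Sum>x\<in>set_mset T. order G)"
      using zero_sum_free_count_less_order[OF fin T] by (intro sum_mono less_imp_le)
    also have "\<dots> \<le> order G * order G"
      using card_mono[OF fin, of "set_mset T"] T unfolding zero_sum_free_def order_def by simp
    finally show ?thesis .
  qed
  then have "finite {size S | S. zero_sum_free G S}"
    by (intro finite_subset[of "{size S | S. zero_sum_free G S}" "{..order G * order G}"]) auto
  then show ?thesis
    unfolding small_davenport_def using assms(2) by (intro Max_ge) auto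
qed

section \<open>Integer vectors as coordinates for \<open>cyclic_sum\<close>\<close>

text \<open>The projection from integer vectors onto the group, in canonical representatives. Group
  computations can thus be done with unreduced integers, entries past \<open>length ns\<close> being
  ignored. For a modulus \<open>0\<close> the entry is kept as it is, in agreement with
  \<open>integer_mod_group 0\<close> being the integers.\<close>

definition residues :: "nat list \<Rightarrow> (nat \<Rightarrow> int) \<Rightarrow> nat \<Rightarrow> int" where
  "residues ns x = (\<lambda>i\<in>{..<length ns}. x i mod int (ns ! i))"

lemma comm_group_cyclic_sum: "comm_group (cyclic_sum ns)"
proof -
  interpret group "cyclic_sum ns" by (simp add: cyclic_sum_def)
  show ?thesis
    by (rule group_comm_groupI) (simp add: cyclic_sum_def add.commute)
qed

lemma one_cyclic_sum: "\<one>\<^bsub>cyclic_sum ns\<^esub> = residues ns (\<lambda>_. 0)"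
  by (simp add: cyclic_sum_def residues_def)

lemma residues_closed: "residues ns x \<in> carrier (cyclic_sum ns)"
  by (auto simp: cyclic_sum_def residues_def carrier_integer_mod_group)

lemma residues_id: "x \<in> carrier (cyclic_sum ns) \<Longrightarrow> residues ns x = x"
  unfolding residues_def
  by (rule extensionalityI[of _ "{..<length ns}"])
    (auto simp: cyclic_sum_def carrier_integer_mod_group PiE_iff split: if_splits,
     metis lessThan_iff mod_by_0 mod_pos_pos_trivial of_nat_0)

lemma residues_mult:
  "residues ns x \<otimes>\<^bsub>cyclic_sum ns\<^esub> residues ns y = residues ns (\<lambda>i. x i + y i)"
  by (auto simp: cyclic_sum_def residues_def mod_add_eq intro!: restrict_ext)

lemma residues_eq_iff:
  "residues ns x = residues ns y \<longleftrightarrow> (\<forall>i<length ns. x i mod int (ns ! i) = y i mod int (ns ! i))"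
  by (auto simp: residues_def fun_eq_iff restrict_def)

lemma residues_eq_one_iff:
  "residues ns x = \<one>\<^bsub>cyclic_sum ns\<^esub> \<longleftrightarrow> (\<forall>i<length ns. int (ns ! i) dvd x i)"
  by (simp add: one_cyclic_sum residues_eq_iff dvd_eq_mod_eq_0)

lemma residues_inv: "inv\<^bsub>cyclic_sum ns\<^esub> residues ns x = residues ns (\<lambda>i. - x i)"
proof -
  interpret comm_group "cyclic_sum ns" by (rule comm_group_cyclic_sum)
  show ?thesis
    by (rule inv_equality) (simp_all add: residues_mult residues_closed one_cyclic_sum)
qed

lemma residues_pow:
  "residues ns x [^]\<^bsub>cyclic_sum ns\<^esub> (d::nat) = residues ns (\<lambda>i. int d * x i)"
proof -
  interpret comm_group "cyclic_sum ns" by (rule comm_group_cyclic_sum)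
  show ?thesis
    by (induction d) (simp_all add: residues_mult one_cyclic_sum algebra_simps)
qed

lemma seq_sum_residues:
  "seq_sum (cyclic_sum ns) (image_mset (\<lambda>j. residues ns (V j)) M)
    = residues ns (\<lambda>i. \<Sum>j\<in>#M. V j i)"
proof -
  interpret comm_group "cyclic_sum ns" by (rule comm_group_cyclic_sum)
  show ?thesis
  proof (induction M)
    case empty
    then show ?case by (simp add: seq_sum_def one_cyclic_sum)
  next
    case (add x M)
    then show ?case
      by (simp add: seq_sum_add_mset residues_closed image_subset_iff residues_mult)
  qed
qed

lemma sum_mset_eq_sum_count:
  fixes f :: "'a \<Rightarrow> int"
  assumes "finite A" "set_mset M \<subseteq> A"
  shows "(\<Sum>j\<in>#M. f j) = (\<Sum>j\<in>A. int (count M j) * f j)"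
  using assms(2)
proof (induction M)
  case (add x M)
  then have "x \<in> A" by simp
  have "(\<Sum>j\<in>A. int (count (add_mset x M) j) * f j)
      = (\<Sum>j\<in>A. (if j = x then f j else 0) + int (count M j) * f j)"
    by (intro sum.cong) (auto simp: algebra_simps)
  then show ?case
    using add \<open>x \<in> A\<close> assms(1) by (simp add: sum.distrib)
qed simp

lemma finite_carrier_cyclic_sum:
  assumes "\<forall>n\<in>set ns. 0 < n"
  shows "finite (carrier (cyclic_sum ns))"
  using assms by (auto simp: cyclic_sum_def carrier_integer_mod_group intro!: finite_PiE)

section \<open>Generating sets and rank\<close>

text \<open>Back substitution over the integers: the rows span all integer vectors before any
  reduction, so the moduli are irrelevant.\<close>

lemma generate_unitriangular:
  assumes diag: "\<And>j. j < length ns \<Longrightarrow> V j j = 1"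
    and lower: "\<And>i j. j < length ns \<Longrightarrow> i < j \<Longrightarrow> V j i = 0"
  shows "generate (cyclic_sum ns) ((\<lambda>j. residues ns (V j)) ` {..<length ns})
    = carrier (cyclic_sum ns)" (is "generate ?G ?A = _")
proof -
  let ?n = "length ns"
  define U where "U j = (\<lambda>i::nat. of_bool (i = j) :: int)" for j :: nat
  interpret comm_group ?G by (rule comm_group_cyclic_sum)
  have sub: "?A \<subseteq> carrier ?G" by (auto simp: residues_closed)
  \<comment> \<open>\<open>L\<close> is the preimage of the generated subgroup among integer
    vectors. Closure under integer combinations lets the argument run as linear algebra.\<close>
  define L where "L = {x. residues ns x \<in> generate ?G ?A}"
  have L0: "(\<lambda>_. 0) \<in> L"
    unfolding L_def by (simp add: one_cyclic_sum[symmetric] generate.one)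
  have Ladd: "(\<lambda>i. x i + y i) \<in> L" if "x \<in> L" "y \<in> L" for x y
    using that generate.eng unfolding L_def by (fastforce simp: residues_mult[symmetric])
  have Lneg: "(\<lambda>i. - x i) \<in> L" if "x \<in> L" for x
    using that generate_m_inv_closed[OF sub] unfolding L_def by (fastforce simp: residues_inv[symmetric])
  have Lnat: "(\<lambda>i. int d * x i) \<in> L" if "x \<in> L" for x d
  proof (induction d)
    case (Suc d)
    then show ?case using Ladd[OF that Suc] by (simp add: algebra_simps)
  qed (simp add: L0)
  have Lint: "(\<lambda>i. c * x i) \<in> L" if "x \<in> L" for x c
  proof (cases c)
    case (nonneg d)
    then show ?thesis using Lnat[OF that] by simp
  next
    case (neg d)
    then have "c * y = - (int (Suc d) * y)" for y by (simp only: mult_minus_left)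
    then show ?thesis using Lneg[OF Lnat[OF that, of "Suc d"]] by simp
  qed
  have Lsum: "(\<lambda>i. \<Sum>j\<in>J. c j * X j i) \<in> L" if "finite J" "\<And>j. j \<in> J \<Longrightarrow> X j \<in> L" for c J X
    using that by (induction J) (auto simp: L0 intro!: Ladd Lint)
  have Lcong: "x \<in> L" if "y \<in> L" "\<And>i. i < ?n \<Longrightarrow> x i = y i" for x y
    using that residues_eq_iff[of ns x y] unfolding L_def by simp
  have unit_sum: "(\<Sum>j\<in>J. c j * U j i) = (if i \<in> J then c i else 0)" if "finite J" for J c i
    using that by (simp add: U_def)
  have UL: "U j \<in> L" if "j < ?n" for j
    using that
  \<comment> \<open>The induction runs from the last row upwards: the unit vectors of larger index
    are already in \<open>L\<close> and clear the entries of row \<open>j\<close> to the right of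
    the diagonal.\<close>
  proof (induction "?n - j" arbitrary: j rule: less_induct)
    case less
    have "V j \<in> L"
      using less.prems unfolding L_def by (auto intro: generate.incl)
    moreover have "(\<lambda>i. \<Sum>k\<in>{j<..<?n}. - V j k * U k i) \<in> L"
      using less by (intro Lsum) auto
    ultimately have "(\<lambda>i. V j i + (\<Sum>k\<in>{j<..<?n}. - V j k * U k i)) \<in> L"
      by (rule Ladd)
    then show ?case
    proof (rule Lcong)
      fix i assume "i < ?n"
      then show "U j i = V j i + (\<Sum>k\<in>{j<..<?n}. - V j k * U k i)"
        using less.prems diag lower unfolding unit_sum[OF finite_greaterThanLessThan]
        by (cases i j rule: linorder_cases) (auto simp: U_def)
    qed
  qed
  have all: "x \<in> L" for x
  proof (rule Lcong)
    show "(\<lambda>i. \<Sum>j\<in>{..<?n}. x j * U j i) \<in> L"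
      using UL by (intro Lsum) auto
  qed (subst unit_sum; simp)
  have "x \<in> generate ?G ?A" if "x \<in> carrier ?G" for x
    using all[of x] residues_id[OF that] by (simp add: L_def)
  then show ?thesis
    using generate_incl[OF sub] by blast
qed

text \<open>The coordinates of an element of the generated subgroup depend, modulo \<open>d\<close>, only on exponents
  modulo \<open>d\<close>; hence \<open>d ^ length ns \<le> d ^ card A\<close>.\<close>

lemma length_le_card_generating:
  assumes d: "1 < d" "\<forall>n\<in>set ns. 0 < n \<and> d dvd n"
    and A: "A \<subseteq> carrier (cyclic_sum ns)" "finite A"
    and gen: "generate (cyclic_sum ns) A = carrier (cyclic_sum ns)"
  shows "length ns \<le> card A"
proof -
  let ?G = "cyclic_sum ns" and ?n = "length ns"
  interpret comm_group ?G by (rule comm_group_cyclic_sum)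
  have mod_mod: "(y mod int (ns ! i)) mod int d = y mod int d" if "i < ?n" for y i
    using that d(2) by (intro mod_mod_cancel) auto
  define good where
    "good x \<longleftrightarrow> (\<exists>c. \<forall>i<?n. x i mod int d = (\<Sum>a\<in>A. c a * a i) mod int d)" for x
  have res: "good (residues ns x) \<longleftrightarrow> good x" for x
    unfolding good_def by (simp add: residues_def mod_mod)
  have good: "good x" if "x \<in> generate ?G A" for x
    using that
  proof induction
    case one
    show ?case
      unfolding one_cyclic_sum res unfolding good_def by (rule exI[of _ "\<lambda>_. 0"]) simp
  next
    case (incl h)
    show ?case
      unfolding good_def
      by (rule exI[of _ "\<lambda>a. of_bool (a = h)"]) (use incl A in simp)
  next
    case (inv h)
    then have "inv\<^bsub>?G\<^esub> h = residues ns (\<lambda>i. - h i)"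
      using A residues_inv[of ns h] residues_id[of h ns] by auto
    moreover have "good (\<lambda>i. - h i)"
      unfolding good_def using inv A(2) by (intro exI[of _ "\<lambda>a. - of_bool (a = h)"]) (simp add: sum_negf)
    ultimately show ?case by (simp add: res)
  next
    case (eng h1 h2)
    then have "h1 \<otimes>\<^bsub>?G\<^esub> h2 = residues ns (\<lambda>i. h1 i + h2 i)"
      using residues_mult[of ns h1 h2] residues_id[of h1 ns] residues_id[of h2 ns] gen by simp
    moreover obtain c1 c2 where
      "\<forall>i<?n. h1 i mod int d = (\<Sum>a\<in>A. c1 a * a i) mod int d"
      "\<forall>i<?n. h2 i mod int d = (\<Sum>a\<in>A. c2 a * a i) mod int d"
      using eng unfolding good_def by blast
    then have "\<forall>i<?n. (h1 i + h2 i) mod int d = (\<Sum>a\<in>A. (c1 a + c2 a) * a i) mod int d"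
      unfolding distrib_right sum.distrib by (intro allI impI mod_add_cong) simp_all
    then have "good (\<lambda>i. h1 i + h2 i)"
      unfolding good_def by (rule exI[of _ "\<lambda>a. c1 a + c2 a"])
    ultimately show ?case by (simp add: res)
  qed
  \<comment> \<open>\<open>?C\<close> holds the coefficient vectors modulo \<open>d\<close>,
    \<open>?F\<close> the coordinate vectors modulo \<open>d\<close>. Surjectivity of
    \<open>ev\<close> from \<open>?C\<close> onto \<open>?F\<close> gives the inequality of
    powers.\<close>
  let ?F = "PiE {..<?n} (\<lambda>_. {0..<int d})" and ?C = "PiE A (\<lambda>_. {0..<int d})"
  define ev where "ev c = (\<lambda>i\<in>{..<?n}. (\<Sum>a\<in>A. c a * a i) mod int d)" for c
  have "?F \<subseteq> ev ` ?C"
  proof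
    fix f assume f: "f \<in> ?F"
    \<comment> \<open>Since \<open>d\<close> is at most every modulus, a vector with entries below
      \<open>d\<close> is itself a canonical representative, so \<open>good\<close> applies to
      it.\<close>
    have "f \<in> carrier ?G"
    proof -
      have "f i < int (ns ! i)" if "i < ?n" for i
      proof -
        have "f i < int d" using f that by (auto simp: PiE_iff)
        also have "int d \<le> int (ns ! i)" using that d by (simp add: dvd_imp_le)
        finally show ?thesis .
      qed
      then show ?thesis
        using f by (auto simp: cyclic_sum_def carrier_integer_mod_group PiE_iff)
    qed
    then obtain c where c: "\<forall>i<?n. f i mod int d = (\<Sum>a\<in>A. c a * a i) mod int d"
      using good gen unfolding good_def by blast
    define c' where "c' = (\<lambda>a\<in>A. c a mod int d)"
    have "c' \<in> ?C" using d by (auto simp: c'_def)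
    moreover have "f = ev c'"
    proof
      fix i
      show "f i = ev c' i"
      proof (cases "i < ?n")
        case True
        have "f i = f i mod int d" using f True by (auto simp: PiE_iff)
        also have "\<dots> = (\<Sum>a\<in>A. c a * a i) mod int d" using c True by simp
        also have "\<dots> = (\<Sum>a\<in>A. (c a * a i) mod int d) mod int d" by (simp add: mod_sum_eq)
        also have "\<dots> = (\<Sum>a\<in>A. (c' a * a i) mod int d) mod int d"
          by (rule arg_cong[where f = "\<lambda>x. x mod int d"], rule sum.cong)
            (simp_all add: c'_def mod_mult_left_eq)
        also have "\<dots> = ev c' i" using True by (simp add: ev_def mod_sum_eq)
        finally show ?thesis .
      next
        case False
        then show ?thesis using f by (auto simp: ev_def PiE_iff extensional_def)
      qed
    qed
    ultimately show "f \<in> ev ` ?C" by blast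
  qed
  then have "card ?F \<le> card ?C"
    using A(2) by (intro surj_card_le) (auto intro: finite_PiE)
  then have "d ^ ?n \<le> d ^ card A"
    using A(2) by (simp add: card_PiE)
  then show ?thesis
    using power_le_imp_le_exp[OF d(1)] by simp
qed

text \<open>The unit vectors give the upper bound. The lower bound comes from the quotient modulo
  the common divisor \<open>d\<close>, where all factors become cyclic of the same order
  \<open>d\<close>.\<close>

lemma group_rank_cyclic_sum:
  assumes "1 < d" "\<forall>n\<in>set ns. 0 < n \<and> d dvd n"
  shows "group_rank (cyclic_sum ns) = length ns"
proof (rule antisym)
  let ?G = "cyclic_sum ns"
  let ?P = "\<lambda>k. \<exists>A. A \<subseteq> carrier ?G \<and> finite A \<and> card A = k \<and> generate ?G A = carrier ?G"
  let ?B = "(\<lambda>j. residues ns (\<lambda>i. of_bool (i = j))) ` {..<length ns}"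
  have B: "?P (card ?B)"
  proof (intro exI conjI)
    show "?B \<subseteq> carrier ?G" by (rule image_subsetI) (rule residues_closed)
    show "generate ?G ?B = carrier ?G"
      by (rule generate_unitriangular) auto
  qed (rule finite_imageI finite_lessThan refl)+
  then have "group_rank ?G \<le> card ?B"
    unfolding group_rank_def by (rule Least_le)
  also have "\<dots> \<le> length ns"
    using card_image_le[of "{..<length ns}"] by simp
  finally show "group_rank ?G \<le> length ns" .
  from B have "?P (group_rank ?G)"
    unfolding group_rank_def by (rule LeastI)
  then obtain A where "A \<subseteq> carrier ?G" "finite A" "card A = group_rank ?G" "generate ?G A = carrier ?G"
    by blast
  then show "length ns \<le> group_rank ?G"
    using length_le_card_generating[OF assms, of A] by simp
qed

section \<open>Torsion counts and uniqueness of invariant factors\<close>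

text \<open>With \<open>g = gcd d n\<close>, the numbers \<open>n div g\<close> and
  \<open>d div g\<close> are coprime, so the solutions are the multiples of \<open>n div g\<close>;
  exactly \<open>g\<close> of them lie below \<open>n\<close>.\<close>

lemma card_multiples_kernel:
  assumes "0 < n"
  shows "card {a \<in> {0..<int n}. int n dvd int d * a} = gcd d n"
proof -
  define g where "g = gcd d n"
  define q where "q = n div g"
  have g: "0 < g" using assms by (simp add: g_def)
  have n: "n = q * g" by (simp add: q_def g_def)
  have q: "0 < q" using assms n by (cases q) auto
  define e where "e = d div g"
  have e: "d = e * g" by (simp add: e_def g_def)
  have "coprime q e"
    using assms div_gcd_coprime[of n d] by (simp add: q_def e_def g_def gcd.commute)
  then have dvd: "int n dvd int d * a \<longleftrightarrow> int q dvd a" for a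
  proof -
    have "int n dvd int d * a \<longleftrightarrow> int g * int q dvd int g * (int e * a)"
      by (simp add: n e mult_ac)
    also have "\<dots> \<longleftrightarrow> int q dvd int e * a" using g by simp
    also have "\<dots> \<longleftrightarrow> int q dvd a"
      using \<open>coprime q e\<close> by (simp add: coprime_dvd_mult_right_iff)
    finally show ?thesis .
  qed
  have "{a \<in> {0..<int n}. int n dvd int d * a} = (\<lambda>b. int q * b) ` {0..<int g}"
  proof (intro equalityI subsetI)
    fix a assume "a \<in> {a \<in> {0..<int n}. int n dvd int d * a}"
    then have a: "0 \<le> a" "a < int q * int g" "int q dvd a" by (simp_all add: dvd) (simp add: n)
    then obtain b where "a = int q * b" by (elim dvdE)
    with a q show "a \<in> (\<lambda>b. int q * b) ` {0..<int g}"
      by (auto simp: zero_le_mult_iff)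
  next
    fix a assume "a \<in> (\<lambda>b. int q * b) ` {0..<int g}"
    then show "a \<in> {a \<in> {0..<int n}. int n dvd int d * a}"
      unfolding mem_Collect_eq dvd using q by (auto simp: n)
  qed
  moreover have "inj_on (\<lambda>b. int q * b) {0..<int g}"
    using q by (auto simp: inj_on_def)
  ultimately show ?thesis by (simp add: card_image g_def)
qed

text \<open>The torsion condition splits over the coordinates, so the kernel is a product of the
  kernels just counted. These numbers are the isomorphism invariant that distinguishes lists of
  factors.\<close>

lemma card_torsion_cyclic_sum:
  assumes "\<forall>n\<in>set ns. 0 < n"
  shows "card {x \<in> carrier (cyclic_sum ns). x [^]\<^bsub>cyclic_sum ns\<^esub> d = \<one>\<^bsub>cyclic_sum ns\<^esub>}
    = prod_list (map (gcd d) ns)"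
proof -
  let ?K = "\<lambda>i. {a \<in> {0..<int (ns ! i)}. int (ns ! i) dvd int d * a}"
  have pow: "x [^]\<^bsub>cyclic_sum ns\<^esub> d = \<one>\<^bsub>cyclic_sum ns\<^esub> \<longleftrightarrow> (\<forall>i<length ns. int (ns ! i) dvd int d * x i)"
    if "x \<in> carrier (cyclic_sum ns)" for x
    using residues_pow[of ns x d] residues_id[OF that] by (simp add: residues_eq_one_iff)
  have car: "x \<in> carrier (cyclic_sum ns) \<longleftrightarrow> x \<in> PiE {..<length ns} (\<lambda>i. {0..<int (ns ! i)})" for x
    using assms by (auto simp: cyclic_sum_def carrier_integer_mod_group PiE_iff)
  have "{x \<in> carrier (cyclic_sum ns). x [^]\<^bsub>cyclic_sum ns\<^esub> d = \<one>\<^bsub>cyclic_sum ns\<^esub>}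
      = PiE {..<length ns} ?K"
    using pow unfolding car by (auto simp: PiE_iff extensional_def)
  also have "card \<dots> = (\<Prod>i<length ns. card (?K i))"
    by (rule card_PiE) simp
  also have "\<dots> = (\<Prod>i<length ns. gcd d (ns ! i))"
    using assms by (intro prod.cong card_multiples_kernel) auto
  also have "\<dots> = prod_list (map (gcd d) ns)"
    by (simp add: prod.list_conv_set_nth atLeast0LessThan)
  finally show ?thesis .
qed

lemma card_torsion_iso:
  assumes "group G" "group H" "G \<cong> H"
  shows "card {x \<in> carrier G. x [^]\<^bsub>G\<^esub> (d::nat) = \<one>\<^bsub>G\<^esub>} = card {x \<in> carrier H. x [^]\<^bsub>H\<^esub> d = \<one>\<^bsub>H\<^esub>}"
    (is "card ?X = card ?Y")
proof -
  obtain h where h: "h \<in> iso G H"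
    using assms(3) unfolding is_iso_def by blast
  interpret group_hom G H h
    using assms h by (simp add: group_hom_def group_hom_axioms_def iso_def)
  have inj: "inj_on h (carrier G)" and surj: "h ` carrier G = carrier H"
    using h by (simp_all add: iso_def bij_betw_def)
  have pow: "h x [^]\<^bsub>H\<^esub> d = \<one>\<^bsub>H\<^esub> \<longleftrightarrow> x [^]\<^bsub>G\<^esub> d = \<one>\<^bsub>G\<^esub>" if "x \<in> carrier G" for x
    using inj_on_eq_iff[OF inj, of "x [^]\<^bsub>G\<^esub> d" "\<one>\<^bsub>G\<^esub>"] that by (simp add: hom_nat_pow)
  have "h ` ?X = ?Y"
  proof (intro equalityI subsetI)
    fix y assume "y \<in> h ` ?X"
    then obtain x where "x \<in> carrier G" "x [^]\<^bsub>G\<^esub> d = \<one>\<^bsub>G\<^esub>" "y = h x"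
      by blast
    then show "y \<in> ?Y" using pow[of x] by simp
  next
    fix y assume y: "y \<in> ?Y"
    then obtain x where "x \<in> carrier G" "y = h x"
      using surj by (metis (no_types, lifting) imageE mem_Collect_eq)
    with y pow[of x] show "y \<in> h ` ?X" by simp
  qed
  moreover have "inj_on h ?X"
    using inj by (rule inj_on_subset) blast
  ultimately show ?thesis
    using card_image[of h ?X] by simp
qed

lemma prod_list_gcd_eq:
  fixes ns :: "nat list"
  assumes "\<forall>k\<in>set ns. k dvd d"
  shows "prod_list (map (gcd d) ns) = prod_list ns"
  using assms by (induction ns) (auto simp: gcd_nat.absorb2)

lemma prod_list_gcd_le:
  fixes ns :: "nat list"
  assumes "\<forall>k\<in>set ns. 0 < k"
  shows "prod_list (map (gcd d) ns) \<le> prod_list ns"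
  using assms by (induction ns) (auto intro!: mult_mono gcd_le2_nat)

text \<open>The largest factors are identified first: evaluating at each of them shows that each
  divides the other. Their common gcd then cancels from every product, and induction handles the
  shorter lists.\<close>

lemma dvd_chain_unique:
  fixes ns ms :: "nat list"
  assumes "\<forall>n\<in>set ns. 1 < n" "sorted_wrt (dvd) ns" "\<forall>n\<in>set ms. 1 < n" "sorted_wrt (dvd) ms"
    and "\<And>d. prod_list (map (gcd d) ns) = prod_list (map (gcd d) ms)"
  shows "ns = ms"
  using assms
proof (induction ns arbitrary: ms rule: rev_induct)
  case Nil
  \<comment> \<open>At \<open>d = 0\<close> every gcd is the entry itself, so the hypothesis
    compares the full products.\<close>
  have "prod_list ms = 1"
    using Nil(5)[of 0] by simp
  then show ?case
    using Nil(3) by (cases ms) auto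
next
  case (snoc n ns)
  have n: "\<forall>k\<in>set (ns @ [n]). k dvd n" "1 < n"
    using snoc.prems by (auto simp: sorted_wrt_append)
  have prods: "prod_list (ns @ [n]) = prod_list ms"
    using snoc.prems(5)[of 0] by simp
  have "ms \<noteq> []"
  proof
    assume "ms = []"
    with prods n(2) show False by (simp)
  qed
  then obtain ms' m where ms: "ms = ms' @ [m]"
    by (metis rev_exhaust)
  have m: "\<forall>k\<in>set ms. k dvd m" "1 < m"
    using snoc.prems unfolding ms by (auto simp: sorted_wrt_append)
  \<comment> \<open>As \<open>x\<close> is a multiple of every entry of \<open>xs\<close>, gcds with
    \<open>x\<close> preserve the product of \<open>xs\<close>, hence also that of
    \<open>ys @ [y]\<close>. No factor can then shrink, which forces
    \<open>gcd x y = y\<close>.\<close>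
  have last_dvd: "y dvd x"
    if x: "\<forall>k\<in>set xs. k dvd x" and pos: "\<forall>k\<in>set (ys @ [y]). 0 < k"
      and eq: "prod_list (map (gcd x) xs) = prod_list (map (gcd x) (ys @ [y]))"
      and all: "prod_list xs = prod_list (ys @ [y])"
    for x y :: nat and xs ys
  proof -
    have "prod_list (ys @ [y]) = prod_list (map (gcd x) (ys @ [y]))"
      using prod_list_gcd_eq[OF x] eq all by simp
    also have "\<dots> \<le> prod_list ys * gcd x y"
      using prod_list_gcd_le[of ys x] pos by simp
    finally have "prod_list ys * y \<le> prod_list ys * gcd x y" by simp
    moreover have "0 < prod_list ys"
      using pos by (induction ys) auto
    ultimately have "y \<le> gcd x y" by simp
    then show ?thesis
      using pos by (metis gcd_dvd1 gcd_le2_nat le_antisym list.set_intros(1) not_gr_zero set_append UnCI)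
  qed
  have "m dvd n"
    using snoc.prems(3) snoc.prems(5)[of n] prods unfolding ms by (intro last_dvd[OF n(1), of ms' m]) auto
  moreover have "n dvd m"
    using snoc.prems(1) snoc.prems(5)[of m] prods by (intro last_dvd[OF m(1), of ns n]) (auto simp: ms)
  ultimately have mn: "m = n" by (rule dvd_antisym)
  have "ns = ms'"
  proof (rule snoc.IH)
    fix d
    show "prod_list (map (gcd d) ns) = prod_list (map (gcd d) ms')"
      using snoc.prems(5)[of d] n(2) unfolding ms mn by auto
  qed (use snoc.prems in \<open>auto simp: ms sorted_wrt_append\<close>)
  then show ?case by (simp add: ms mn)
qed

text \<open>This is what gives the definite description in \<open>d_star\<close> its value.\<close>

lemma invariant_factors_unique:
  assumes ns: "invariant_factors G ns" and ms: "invariant_factors G ms" and "group G"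
  shows "ns = ms"
proof (rule dvd_chain_unique)
  fix d :: nat
  have "prod_list (map (gcd d) ks) = card {x \<in> carrier G. x [^]\<^bsub>G\<^esub> d = \<one>\<^bsub>G\<^esub>}"
    if "invariant_factors G ks" for ks
  proof -
    have "\<forall>n\<in>set ks. 0 < n"
      using that by (auto simp: invariant_factors_def)
    moreover have "group (cyclic_sum ks)"
      using comm_group_cyclic_sum comm_group_def by blast
    ultimately show ?thesis
      using card_torsion_iso[of G "cyclic_sum ks" d] card_torsion_cyclic_sum[of ks d] that \<open>group G\<close>
      by (simp add: invariant_factors_def)
  qed
  with ns ms show "prod_list (map (gcd d) ns) = prod_list (map (gcd d) ms)" by simp
qed (use ns ms in \<open>auto simp: invariant_factors_def\<close>)

lemma sorted_wrt_dvd_replicate: "sorted_wrt (dvd) (replicate n (x::nat))"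
  by (induction n) auto

lemma d_star_cyclic_sum:
  assumes "\<forall>n\<in>set ns. 1 < n" "sorted_wrt (dvd) ns"
  shows "d_star (cyclic_sum ns) = (\<Sum>n\<leftarrow>ns. n - 1)"
proof -
  have "invariant_factors (cyclic_sum ns) ns"
    using assms by (simp add: invariant_factors_def iso_refl)
  then have "(THE ms. invariant_factors (cyclic_sum ns) ms) = ns"
    using invariant_factors_unique comm_group_cyclic_sum comm_group_def by (metis the_equality)
  then show ?thesis by (simp add: d_star_def)
qed

section \<open>The explicit sequence and its zero-sum freeness\<close>

text \<open>Found by computer search.  The last five columns, read in \<open>C\<^sub>2\<^sup>4 \<oplus> C\<^sub>6\<close>, are the eight distinct
  terms; the row with entry \<open>-1\<close> is taken three times and the others once.  The first three columns
  lift them to rows that are independent modulo \<open>m\<close>.\<close>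

definition base_matrix :: "int list list" where
  "base_matrix =
    [[1, 0, 0, 1, 1, 0, 0, 1],
     [0, 1, 0, 1, 0, 1, 0, 1],
     [0, 0, 1, 1, 1, 1, 1, 2],
     [0, 0, 0, 1, 0, 0, 0, 1],
     [0, 0, 0, 0, 1, 0, 0, 1],
     [0, 0, 0, 0, 0, 1, 0, 1],
     [0, 0, 0, 0, 0, 0, 1, -1],
     [0, 0, 0, 0, 0, 0, 0, 1]]"

text \<open>A block diagonal matrix: the identity of size \<open>k\<close> followed by
  \<open>base_matrix\<close>. With \<open>k = r - 8\<close> its rows are the \<open>r\<close>
  generators.\<close>

definition lift_row :: "nat \<Rightarrow> nat \<Rightarrow> nat \<Rightarrow> int" where
  "lift_row k j i = (if j < k \<or> i < k then of_bool (i = j) else base_matrix ! (j - k) ! (i - k))"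

text \<open>The multiplicities \<open>v * m + m - 1\<close>, with \<open>v = 0\<close> on the
  identity block, \<open>v = 3\<close> for the row with entry \<open>-1\<close>, and
  \<open>v = 1\<close> for the other rows of the base block.\<close>

definition multiplicity_bound :: "nat \<Rightarrow> nat \<Rightarrow> nat \<Rightarrow> nat" where
  "multiplicity_bound k m j =
    (if j < k then m - 1 else if j = k + 6 then 4 * m - 1 else 2 * m - 1)"

lemma base_sequence_zero_sum_free:
  fixes y :: "nat \<Rightarrow> int"
  assumes "\<And>t. 0 \<le> y t" "y 0 \<le> 1" "y 1 \<le> 1" "y 2 \<le> 1" "y 3 \<le> 1" "y 4 \<le> 1" "y 5 \<le> 1" "y 6 \<le> 3" "y 7 \<le> 1"
    and c: "2 dvd y 0 + y 1 + y 2 + y 3" "2 dvd y 0 + y 2 + y 4" "2 dvd y 1 + y 2 + y 5" "2 dvd y 2 + y 6"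
      "6 dvd y 0 + y 1 + 2 * y 2 + y 3 + y 4 + y 5 - y 6 + y 7"
    and "t < 8"
  shows "y t = 0"
proof -
  have b: "y t = 0 \<or> y t = 1" if "y t \<le> 1" for t
    using that assms(1)[of t] by linarith
  have "y 6 = 0 \<or> y 6 = 1 \<or> y 6 = 2 \<or> y 6 = 3"
    using assms(1)[of 6] assms(8) by linarith
  \<comment> \<open>The bounds leave \<open>4 * 2 ^ 7\<close> vectors of multiplicities, which are
    checked exhaustively against the five congruences.\<close>
  then have "y 0 = 0 \<and> y 1 = 0 \<and> y 2 = 0 \<and> y 3 = 0 \<and> y 4 = 0 \<and> y 5 = 0 \<and> y 6 = 0 \<and> y 7 = 0"
    using b[OF assms(2)] b[OF assms(3)] b[OF assms(4)] b[OF assms(5)] b[OF assms(6)] b[OF assms(7)]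
      b[OF assms(9)] c
    by (elim disjE) simp_all
  moreover have "t \<in> {0, 1, 2, 3, 4, 5, 6, 7}" using \<open>t < 8\<close> by auto
  ultimately show ?thesis by auto
qed

lemma lessThan_8: "{..<8::nat} = {0, 1, 2, 3, 4, 5, 6, 7}"
  by auto

lemma sum_lift_row:
  fixes b :: "nat \<Rightarrow> int"
  shows "i < k \<Longrightarrow> (\<Sum>j<k + 8. b j * lift_row k j i) = b i"
    and "(\<Sum>j<k + 8. b j * lift_row k j (k + s)) = (\<Sum>t<8. b (k + t) * base_matrix ! t ! s)"
proof -
  assume "i < k"
  then have "(\<Sum>j<k + 8. b j * lift_row k j i) = (\<Sum>j<k + 8. if j = i then b i else 0)"
    by (intro sum.cong) (auto simp: lift_row_def)
  then show "(\<Sum>j<k + 8. b j * lift_row k j i) = b i"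
    using \<open>i < k\<close> by simp
next
  have "(\<Sum>j<k + 8. b j * lift_row k j (k + s))
      = (\<Sum>j<k. b j * lift_row k j (k + s)) + (\<Sum>j\<in>{k..<k + 8}. b j * lift_row k j (k + s))"
    by (subst sum.union_disjoint[symmetric]) (auto simp: ivl_disj_un)
  also have "(\<Sum>j<k. b j * lift_row k j (k + s)) = 0"
    by (intro sum.neutral) (auto simp: lift_row_def)
  also have "(\<Sum>j\<in>{k..<k + 8}. b j * lift_row k j (k + s)) = (\<Sum>t<8. b (k + t) * base_matrix ! t ! s)"
    by (rule sum.reindex_bij_witness[of _ "\<lambda>t. k + t" "\<lambda>j. j - k"]) (auto simp: lift_row_def)
  finally show "(\<Sum>j<k + 8. b j * lift_row k j (k + s)) = (\<Sum>t<8. b (k + t) * base_matrix ! t ! s)"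
    by simp
qed

text \<open>The lifting argument: a relation modulo \<open>m\<close> forces every multiplicity to be
  a multiple of \<open>m\<close>, and the quotients form a relation of the base sequence over
  \<open>m G\<close>.\<close>

lemma lift_row_relation_trivial:
  fixes b :: "nat \<Rightarrow> nat"
  assumes "2 \<le> m"
    and bound: "\<And>j. j < k + 8 \<Longrightarrow> b j \<le> multiplicity_bound k m j"
    and ns: "ns = replicate (k + 3) m @ replicate 4 (2 * m) @ [6 * m]"
    and rel: "\<And>i. i < k + 8 \<Longrightarrow> int (ns ! i) dvd (\<Sum>j<k + 8. int (b j) * lift_row k j i)"
    and "j < k + 8"
  shows "b j = 0"
proof (cases "j < k")
  case True
  then have "ns ! j = m" by (simp add: ns nth_append)
  with True rel[of j] have "m dvd b j"
    by (simp add: sum_lift_row)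
  moreover have "b j < m"
    using bound[of j] True \<open>2 \<le> m\<close> by (simp add: multiplicity_bound_def)
  ultimately show ?thesis using dvd_imp_le by fastforce
next
  case False
  define B where "B t = int (b (k + t))" for t
  have R: "int (if s < 3 then m else if s < 7 then 2 * m else 6 * m)
      dvd (\<Sum>t\<in>{0, 1, 2, 3, 4, 5, 6, 7}. B t * base_matrix ! t ! s)" if "s < 8" for s
  proof -
    have "ns ! (k + s) = (if s < 3 then m else if s < 7 then 2 * m else 6 * m)"
      using that by (auto simp: ns nth_append nth_Cons')
    then show ?thesis
      using rel[of "k + s"] that by (simp only: sum_lift_row lessThan_8 B_def nat_add_left_cancel_less)
  qed
  have r: "int m dvd B 0" "int m dvd B 1" "int m dvd B 2"
    "2 * int m dvd B 0 + B 1 + B 2 + B 3" "2 * int m dvd B 0 + B 2 + B 4"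
    "2 * int m dvd B 1 + B 2 + B 5" "2 * int m dvd B 2 + B 6"
    "6 * int m dvd B 0 + B 1 + 2 * B 2 + B 3 + B 4 + B 5 - B 6 + B 7"
    using R[of 0] R[of 1] R[of 2] R[of 3] R[of 4] R[of 5] R[of 6] R[of 7]
    by (simp_all add: base_matrix_def algebra_simps)
  have m: "int m dvd x" if "2 * int m dvd x \<or> 6 * int m dvd x" for x
    using that by (auto elim: dvd_mult_right)
  \<comment> \<open>Modulo \<open>m\<close> the system is unitriangular: each further column
    introduces one new unknown with coefficient a unit, so divisibility by \<open>m\<close> passes
    from one \<open>B t\<close> to the next.\<close>
  have B3: "int m dvd B 3" using m[of "B 0 + B 1 + B 2 + B 3"] r by (simp add: dvd_add_right_iff)
  have B4: "int m dvd B 4" using m[of "B 0 + B 2 + B 4"] r by (simp add: dvd_add_right_iff)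
  have B5: "int m dvd B 5" using m[of "B 1 + B 2 + B 5"] r by (simp add: dvd_add_right_iff)
  have B6: "int m dvd B 6" using m[of "B 2 + B 6"] r by (simp add: dvd_add_right_iff)
  have "int m dvd B 0 + B 1 + 2 * B 2 + B 3 + B 4 + B 5 - B 6"
    using r B3 B4 B5 B6 by (intro dvd_add dvd_diff dvd_mult) auto
  then have B7: "int m dvd B 7"
    using m[OF disjI2[OF r(8)]] by (simp add: dvd_add_right_iff)
  have "int m dvd B t" if "t < 8" for t
  proof -
    have "t \<in> {0, 1, 2, 3, 4, 5, 6, 7}" using that by auto
    then show ?thesis using r B3 B4 B5 B6 B7 by auto
  qed
  then have By: "B t = int m * (B t div int m)" if "t < 8" for t
    using that by simp
  define y where "y t = B t div int m" for t
  have m0: "0 < int m" using \<open>2 \<le> m\<close> by simp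
  have y: "B 0 = int m * y 0" "B 1 = int m * y 1" "B 2 = int m * y 2" "B 3 = int m * y 3"
    "B 4 = int m * y 4" "B 5 = int m * y 5" "B 6 = int m * y 6" "B 7 = int m * y 7"
    unfolding y_def by (rule By; simp)+
  \<comment> \<open>This is where the extra \<open>m - 1\<close> copies are harmless:
    \<open>2 * m - 1\<close> still has quotient \<open>1\<close> by \<open>m\<close>, and
    \<open>4 * m - 1\<close> has quotient \<open>3\<close>.\<close>
  have up: "y t \<le> c" if "B t < (c + 1) * int m" for t c
    unfolding y_def
  proof (rule ccontr)
    assume "\<not> B t div int m \<le> c"
    then have "(c + 1) * int m \<le> B t div int m * int m"
      using m0 by (intro mult_right_mono) auto
    also have "\<dots> \<le> B t"
      using div_mult_mod_eq[of "B t" "int m"] pos_mod_sign[OF m0, of "B t"] by linarith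
    finally show False using that by linarith
  qed
  have less2: "B t < (1 + 1) * int m" if "t < 8" "t \<noteq> 6" for t
    using bound[of "k + t"] that \<open>2 \<le> m\<close> by (auto simp: B_def multiplicity_bound_def)
  have less4: "B 6 < (3 + 1) * int m"
    using bound[of "k + 6"] \<open>2 \<le> m\<close> by (auto simp: B_def multiplicity_bound_def)
  \<comment> \<open>Cancelling \<open>m\<close> turns the moduli \<open>2 * m\<close> and
    \<open>6 * m\<close> into the moduli \<open>2\<close> and \<open>6\<close> of
    \<open>m G\<close>.\<close>
  have fac: "c dvd z" if "c * int m dvd x" "x = int m * z" for c x z
    using that m0 by (simp add: mult.commute[of c])
  have "y t = 0" if "t < 8" for t
  proof (rule base_sequence_zero_sum_free[OF _ _ _ _ _ _ _ _ _ _ _ _ _ _ that])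
    show "0 \<le> y t" for t using m0 by (simp add: y_def B_def pos_imp_zdiv_nonneg_iff)
    show "y 6 \<le> 3" by (rule up[OF less4])
    show "2 dvd y 0 + y 1 + y 2 + y 3" by (rule fac[OF r(4)]) (simp add: y[unfolded One_nat_def] distrib_left)
    show "2 dvd y 0 + y 2 + y 4" by (rule fac[OF r(5)]) (simp add: y[unfolded One_nat_def] distrib_left)
    show "2 dvd y 1 + y 2 + y 5" by (rule fac[OF r(6)]) (simp add: y[unfolded One_nat_def] distrib_left)
    show "2 dvd y 2 + y 6" by (rule fac[OF r(7)]) (simp add: y[unfolded One_nat_def] distrib_left)
    show "6 dvd y 0 + y 1 + 2 * y 2 + y 3 + y 4 + y 5 - y 6 + y 7"
      by (rule fac[OF r(8)]) (simp add: y[unfolded One_nat_def] algebra_simps)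
  qed (rule up[OF less2]; simp)+
  then have "B (j - k) = 0"
    using By[of "j - k"] False \<open>j < k + 8\<close> by (simp add: y_def)
  then show ?thesis using False by (simp add: B_def)
qed

section \<open>Length of the sequence and conclusion\<close>

lemma count_sum_replicate_mset:
  "count (\<Sum>j<n::nat. replicate_mset (f j) j) i = (if i < n then f i else 0)"
  by (induction n) auto

lemma size_sum_replicate_mset:
  "size (\<Sum>j<n::nat. replicate_mset (f j) j) = (\<Sum>j<n. f j)"
  by (induction n) auto

lemma sum_multiplicity_bound:
  assumes "2 \<le> m"
  shows "int (\<Sum>j<k + 8. multiplicity_bound k m j) = int k * (int m - 1) + 18 * int m - 8"
proof -
  have "(\<Sum>j<k + 8. multiplicity_bound k m j)
      = (\<Sum>j<k. multiplicity_bound k m j) + (\<Sum>j\<in>{k..<k + 8}. multiplicity_bound k m j)"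
    by (subst sum.union_disjoint[symmetric]) (auto simp: ivl_disj_un)
  also have "(\<Sum>j<k. multiplicity_bound k m j) = k * (m - 1)"
    by (simp add: multiplicity_bound_def)
  also have "(\<Sum>j\<in>{k..<k + 8}. multiplicity_bound k m j) = (\<Sum>t<8. multiplicity_bound k m (k + t))"
    by (rule sum.reindex_bij_witness[of _ "\<lambda>t. k + t" "\<lambda>j. j - k"]) auto
  also have "\<dots> = 7 * (2 * m - 1) + (4 * m - 1)"
    by (simp add: lessThan_8 multiplicity_bound_def)
  finally have "(\<Sum>j<k + 8. multiplicity_bound k m j) = k * (m - 1) + (7 * (2 * m - 1) + (4 * m - 1))" .
  \<comment> \<open>Writing \<open>m\<close> as \<open>l + 2\<close> removes the truncated
    subtractions.\<close>
  moreover obtain l where "m = l + 2"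
    using assms by (metis add.commute le_Suc_ex)
  ultimately show ?thesis by (simp add: algebra_simps)
qed

lemma long_zero_sum_free_sequence:
  assumes m: "2 \<le> m"
    and ns: "ns = replicate (k + 3) m @ replicate 4 (2 * m) @ [6 * m]"
  obtains S where "zero_sum_free (cyclic_sum ns) S"
    and "int (size S) = int k * (int m - 1) + 18 * int m - 8"
    and "generate (cyclic_sum ns) (set_mset S) = carrier (cyclic_sum ns)"
proof
  let ?f = "\<lambda>j. residues ns (lift_row k j)"
  \<comment> \<open>Multiplicities are attached to row indices and not to group elements, so the
    argument never has to compare the terms with one another.\<close>
  define M where "M = (\<Sum>j<k + 8. replicate_mset (multiplicity_bound k m j) j)"
  have len: "length ns = k + 8" by (simp add: ns)
  have count_M: "count M i = (if i < k + 8 then multiplicity_bound k m i else 0)" for i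
    unfolding M_def by (rule count_sum_replicate_mset)
  \<comment> \<open>Every row occurs because its multiplicity is at least \<open>m - 1\<close>,
    which is positive; hence the terms include a full unitriangular system.\<close>
  have set_M: "set_mset M = {..<length ns}"
    using m by (auto simp: set_mset_def count_M len multiplicity_bound_def)
  show "int (size (image_mset ?f M)) = int k * (int m - 1) + 18 * int m - 8"
    using sum_multiplicity_bound[OF m] by (simp add: M_def size_sum_replicate_mset)
  have diag: "lift_row k j j = 1" if "j < length ns" for j
  proof (cases "j < k")
    case False
    then have "j - k \<in> {0, 1, 2, 3, 4, 5, 6, 7}" using that len by auto
    then show ?thesis using False by (auto simp: lift_row_def base_matrix_def)
  qed (simp add: lift_row_def)
  have lower: "lift_row k j i = 0" if "j < length ns" "i < j" for i j
  proof (cases "i < k")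
    case False
    then have "j - k \<in> {0, 1, 2, 3, 4, 5, 6, 7}" "i - k < j - k" using that len by auto
    then show ?thesis using False that
      by (auto simp: lift_row_def base_matrix_def less_Suc_eq numeral_eq_Suc)
  qed (use that in \<open>simp add: lift_row_def\<close>)
  show "generate (cyclic_sum ns) (set_mset (image_mset ?f M)) = carrier (cyclic_sum ns)"
    unfolding set_image_mset set_M by (rule generate_unitriangular[OF diag lower])
  show "zero_sum_free (cyclic_sum ns) (image_mset ?f M)"
    unfolding zero_sum_free_def
  proof (intro conjI allI impI)
    show "set_mset (image_mset ?f M) \<subseteq> carrier (cyclic_sum ns)"
      by (auto simp: residues_closed)
    fix T assume T: "T \<subseteq># image_mset ?f M \<and> T \<noteq> {#}"
    \<comment> \<open>The subsequence is pulled back to a multiset \<open>N\<close> of indices,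
      whose counts are the coefficients of the relation.\<close>
    then obtain T' where "image_mset ?f M = T + T'"
      by (auto simp: mset_subset_eq_exists_conv)
    then obtain N N' where "M = N + N'" and "T = image_mset ?f N"
      by (auto dest: image_mset_eq_plusD)
    with T have N: "N \<subseteq># M" "T = image_mset ?f N" "N \<noteq> {#}"
      by auto
    have sub: "set_mset N \<subseteq> {..<k + 8}"
      using set_mset_mono[OF N(1)] by (simp add: set_M len)
    show "seq_sum (cyclic_sum ns) T \<noteq> \<one>\<^bsub>cyclic_sum ns\<^esub>"
    proof
      assume "seq_sum (cyclic_sum ns) T = \<one>\<^bsub>cyclic_sum ns\<^esub>"
      then have "int (ns ! i) dvd (\<Sum>j<k + 8. int (count N j) * lift_row k j i)" if "i < k + 8" for i
        using that len sub by (simp add: N(2) seq_sum_residues residues_eq_one_iff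
            flip: sum_mset_eq_sum_count)
      moreover have "count N j \<le> multiplicity_bound k m j" if "j < k + 8" for j
        using mset_subset_eq_count[OF N(1), of j] that by (simp add: count_M)
      ultimately have "count N j = 0" if "j < k + 8" for j
        using lift_row_relation_trivial[OF m _ ns, of "count N"] that by blast
      with sub have "set_mset N = {}"
        by (metis count_eq_zero_iff lessThan_iff subset_iff subsetI subset_empty)
      then show False using N(3) by simp
    qed
  qed
qed

theorem theorem3p1:
  fixes r m :: nat
  assumes "r \<ge> 8" and "m \<ge> 2"
  shows "group_rank (G_mr m r) = r
    \<and> (\<exists>S. zero_sum_free (G_mr m r) S
          \<and> int (size S) = (int r + 10) * int m - int r
          \<and> generate (G_mr m r) (set_mset S) = carrier (G_mr m r))
    \<and> int (d_star (G_mr m r)) = (int r + 9) * int m - int r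
    \<and> int (small_davenport (G_mr m r)) - int (d_star (G_mr m r)) \<ge> int m"
proof -
  define k where "k = r - 8"
  have r: "r = k + 8" using assms by (simp add: k_def)
  define ns where "ns = replicate (k + 3) m @ replicate 4 (2 * m) @ [6 * m]"
  have G: "G_mr m r = cyclic_sum ns"
    by (simp add: G_mr_def ns_def r add.commute)
  interpret comm_group "cyclic_sum ns" by (rule comm_group_cyclic_sum)
  \<comment> \<open>The common divisor is \<open>m\<close> itself.\<close>
  have rank: "group_rank (cyclic_sum ns) = r"
    using group_rank_cyclic_sum[of m ns] assms(2) by (auto simp: ns_def r)
  have "d_star (cyclic_sum ns) = (\<Sum>n\<leftarrow>ns. n - 1)"
    by (rule d_star_cyclic_sum) (use assms(2) in \<open>auto simp: ns_def sorted_wrt_append sorted_wrt_dvd_replicate\<close>)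
  moreover obtain l where "m = l + 2"
    using assms(2) by (metis add.commute le_Suc_ex)
  ultimately have dstar: "int (d_star (cyclic_sum ns)) = (int r + 9) * int m - int r"
    by (simp add: ns_def r sum_list_replicate algebra_simps)
  obtain S where S: "zero_sum_free (cyclic_sum ns) S"
    "int (size S) = int k * (int m - 1) + 18 * int m - 8"
    "generate (cyclic_sum ns) (set_mset S) = carrier (cyclic_sum ns)"
    using long_zero_sum_free_sequence[OF assms(2) ns_def] .
  have size: "int (size S) = (int r + 10) * int m - int r"
    by (simp add: S(2) r algebra_simps)
  have "finite (carrier (cyclic_sum ns))"
    using assms(2) by (intro finite_carrier_cyclic_sum) (auto simp: ns_def)
  then have "size S \<le> small_davenport (cyclic_sum ns)"
    using S(1) by (rule size_le_small_davenport)
  \<comment> \<open>The length \<open>(r + 10) * m - r\<close> exceeds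
    \<open>(r + 9) * m - r\<close> by exactly \<open>m\<close>.\<close>
  then have "int (small_davenport (cyclic_sum ns)) - int (d_star (cyclic_sum ns)) \<ge> int m"
    using size dstar by (simp add: algebra_simps)
  then show ?thesis
    unfolding G using rank S size dstar by blast
qed

end
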